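(* For every complex number $a$ with $4a+\tfrac12\notin\{0,-1,-2,\dots\}$, $$F_1\left(5a;\,3a-\tfrac12,\,2a;\,4a+\tfrac12;\,\tfrac1{25},\tfrac{16}{25}\right)=\frac{5^{10a-1}}{2^{6a}3^{6a}}\,\frac{\Gamma(a)\,\Gamma(4a+1/2)}{\sqrt\pi\,\Gamma(5a)},$$ where the quotient $\Gamma(a)/\Gamma(5a)$ is understood as an entire function of $a$ (its removable singularities at $a=0,-1,-2,\dots$ being filled in by continuity).
   Context: Appell's hypergeometric series is $F_1(\alpha;\beta_1,\beta_2;\gamma;x,y)=\sum_{m,n\ge0}\frac{(\alpha,m+n)(\beta_1,m)(\beta_2,n)}{(\gamma,m+n)(1,m)(1,n)}x^my^n$ for $\gamma\notin\{0,-1,-2,\dots\}$, absolutely convergent for $|x|<1$, $|y|<1$, where $(\alpha,n)=\alpha(\alpha+1)\cdots(\alpha+n-1)$, $(\alpha,0)=1$. For real $r>0$, $r^{a}=e^{a\log r}$ with real $\log r$. $1/\Gamma$ is the entire function (zero at the poles of $\Gamma$). *)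

theory Defs
  imports "HOL-Complex_Analysis.Complex_Analysis"
begin

definition appell_F1 ::
    "complex \<Rightarrow> complex \<Rightarrow> complex \<Rightarrow> complex \<Rightarrow> complex \<Rightarrow> complex \<Rightarrow> complex" where
  "appell_F1 \<alpha> \<beta>1 \<beta>2 \<gamma> x y =
     (\<Sum>\<^sub>\<infinity>(m, n) \<in> (UNIV :: (nat \<times> nat) set).
        pochhammer \<alpha> (m + n) * pochhammer \<beta>1 m * pochhammer \<beta>2 n
          / (pochhammer \<gamma> (m + n) * pochhammer 1 m * pochhammer 1 n) * x ^ m * y ^ n)"

lemma summable_pochhammer_quotient:
  fixes a c :: complex and t :: real
  assumes c: "c \<notin> \<int>\<^sub>\<le>\<^sub>0" and t: "0 \<le> t" "t < 1"
  shows "summable (\<lambda>n. norm (pochhammer a n / pochhammer c n) * t ^ n)"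
proof -
  define r where "r = (t + 1) / 2"
  have r: "t < r" "r < 1" using t by (auto simp: r_def)
  have "(\<lambda>n. norm ((a + of_nat n) / (c + of_nat n)) * t) \<longlonglongrightarrow> norm (1::complex) * t"
  proof (intro tendsto_intros)
    have 1: "filterlim (\<lambda>n. c + of_nat n :: complex) at_infinity sequentially"
      by (intro tendsto_add_filterlim_at_infinity[OF tendsto_const]  tendsto_of_nat)
    have "(\<lambda>n. 1 + (a - c) * inverse (c + of_nat n)) \<longlonglongrightarrow> 1 + (a - c) * 0"
      by (intro tendsto_intros filterlim_compose[OF tendsto_inverse_0 1])
    moreover have "1 + (a - c) * inverse (c + of_nat n) = (a + of_nat n) / (c + of_nat n)" for n
    proof -
      have "c + of_nat n \<noteq> 0" using c by (metis add_eq_0_iff2 minus_of_nat_in_nonpos_Ints minus_minus)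
      thus ?thesis by (simp add: field_simps)
    qed
    ultimately show "(\<lambda>n. (a + of_nat n) / (c + of_nat n)) \<longlonglongrightarrow> 1" by simp
  qed
  hence "eventually (\<lambda>n. norm ((a + of_nat n) / (c + of_nat n)) * t < r) sequentially"
    by (rule order_tendstoD) (use r in auto)
  then obtain N where N: "\<And>n. n \<ge> N \<Longrightarrow> norm ((a + of_nat n) / (c + of_nat n)) * t < r"
    by (auto simp: eventually_sequentially)
  show ?thesis
  proof (rule summable_ratio_test[of r N])
    fix n assume "n \<ge> N"
    have "norm (norm (pochhammer a (Suc n) / pochhammer c (Suc n)) * t ^ Suc n)
       = (norm ((a + of_nat n) / (c + of_nat n)) * t) * norm (norm (pochhammer a n / pochhammer c n) * t ^ n)"
      using t by (simp add: pochhammer_Suc norm_mult norm_divide abs_mult mult_ac)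
    also have "\<dots> \<le> r * norm (norm (pochhammer a n / pochhammer c n) * t ^ n)"
      by (intro mult_right_mono order.strict_implies_order[OF N] \<open>n \<ge> N\<close> norm_ge_zero)
    finally show "norm (norm (pochhammer a (Suc n) / pochhammer c (Suc n)) * t ^ Suc n)
       \<le> r * norm (norm (pochhammer a n / pochhammer c n) * t ^ n)" .
  qed (use r in auto)
qed

lemma appell_F1_abs_summable:
  fixes \<alpha> \<beta>1 \<beta>2 \<gamma> x y :: complex
  assumes g: "\<gamma> \<notin> \<int>\<^sub>\<le>\<^sub>0" and "norm x < 1" "norm y < 1"
  shows "(\<lambda>(m, n). norm (pochhammer \<alpha> (m + n) * pochhammer \<beta>1 m * pochhammer \<beta>2 n
          / (pochhammer \<gamma> (m + n) * pochhammer 1 m * pochhammer 1 n) * x ^ m * y ^ n))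
          summable_on (UNIV :: (nat \<times> nat) set)"
proof -
  define s where "s = max (norm x) (norm y)"
  define t where "t = (s + 1) / 2"
  have s: "0 \<le> s" "s < 1" "norm x \<le> s" "norm y \<le> s" 
    using assms by (auto simp: s_def le_max_iff_disj)
  have t: "s < t" "t < 1" "0 < t" using s by (auto simp: t_def)
  have one: "(1::complex) \<notin> \<int>\<^sub>\<le>\<^sub>0" by simp
  have "Bseq (\<lambda>n. norm (pochhammer \<alpha> n / pochhammer \<gamma> n) * t ^ n)"
    by (rule convergent_imp_Bseq, rule convergentI, rule summable_LIMSEQ_zero, rule summable_pochhammer_quotient)
       (use g t in auto)
  then obtain C where C: "C > 0" "\<And>n. norm (norm (pochhammer \<alpha> n / pochhammer \<gamma> n) * t ^ n) \<le> C"
    unfolding Bseq_def by blast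
  define u where "u = (\<lambda>m. norm (pochhammer \<beta>1 m / pochhammer 1 m) * (norm x / t) ^ m)"
  define v where "v = (\<lambda>m. norm (pochhammer \<beta>2 m / pochhammer 1 m) * (norm y / t) ^ m)"
  have nn: "u m \<ge> 0" "v m \<ge> 0" for m using t by (auto simp: u_def v_def)
  have "summable u" "summable v" unfolding u_def v_def
    by (rule summable_pochhammer_quotient[OF one]; use s t in \<open>auto simp: field_simps\<close>)+
  hence su: "u summable_on UNIV" "(v has_sum suminf v) UNIV"
    using nn by (auto intro!: norm_summable_imp_summable_on norm_summable_imp_has_sum summable_sums)
  have "(\<lambda>(m, n). C * (u m * v n)) summable_on Sigma UNIV (\<lambda>_. UNIV)"
  proof (rule summable_on_SigmaI)
    show "((\<lambda>n. case (m, n) of (m, n) \<Rightarrow> C * (u m * v n)) has_sum C * (u m * suminf v)) UNIV" for m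
      using su(2) by (auto intro!: has_sum_cmult_right)
    show "(\<lambda>m. C * (u m * suminf v)) summable_on UNIV"
      using su(1) by (intro summable_on_cmult_right summable_on_cmult_left)
  qed (use nn C in auto)
  hence "(\<lambda>(m, n). C * (u m * v n)) summable_on (UNIV :: (nat \<times> nat) set)" by simp
  hence "(\<lambda>z. norm (case z of (m, n) \<Rightarrow> pochhammer \<alpha> (m + n) * pochhammer \<beta>1 m * pochhammer \<beta>2 n
          / (pochhammer \<gamma> (m + n) * pochhammer 1 m * pochhammer 1 n) * x ^ m * y ^ n))
          summable_on UNIV"
  proof (rule Infinite_Sum.abs_summable_on_comparison_test')
    fix z :: "nat \<times> nat"
    obtain m n where z: "z = (m, n)" by force
    have "norm (pochhammer \<alpha> (m + n) * pochhammer \<beta>1 m * pochhammer \<beta>2 n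
          / (pochhammer \<gamma> (m + n) * pochhammer 1 m * pochhammer 1 n) * x ^ m * y ^ n)
      = norm (norm (pochhammer \<alpha> (m+n) / pochhammer \<gamma> (m+n)) * t ^ (m+n)) * (u m * v n)"
      using t by (simp add: u_def v_def norm_mult norm_divide norm_power power_divide power_add mult_ac)
    also have "\<dots> \<le> C * (u m * v n)"
      by (intro mult_right_mono C mult_nonneg_nonneg nn)
    finally show "norm (case z of (m, n) \<Rightarrow> pochhammer \<alpha> (m + n) * pochhammer \<beta>1 m * pochhammer \<beta>2 n
          / (pochhammer \<gamma> (m + n) * pochhammer 1 m * pochhammer 1 n) * x ^ m * y ^ n)
       \<le> (case z of (m, n) \<Rightarrow> C * (u m * v n))" by (simp add: z)
  qed
  thus ?thesis by (simp add: case_prod_unfold)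
qed

(* The library sets Gamma to 0 at its poles and x / 0 = 0, so the plain quotient takes the junk
   value 0 at nonpositive integers (and the correct value 0 at the other poles of Gamma (5 * z));
   remove_sings replaces the value at each point by the limit there. *)
definition Gamma_quotient :: "complex \<Rightarrow> complex" where
  "Gamma_quotient = remove_sings (\<lambda>z. Gamma z / Gamma (5 * z))"

lemma Gamma_quotient_tendsto:
  "(\<lambda>z. Gamma z / Gamma (5 * z)) \<midarrow>a\<rightarrow> Gamma_quotient a"
proof -
  have eq: "Gamma z / Gamma (5 * z) = rGamma (5 * z) / rGamma z" for z :: complex
    by (simp add: rGamma_inverse_Gamma field_simps)
  have "\<exists>c. (\<lambda>z. Gamma z / Gamma (5 * z)) \<midarrow>a\<rightarrow> c"
  proof (cases "a \<in> \<int>\<^sub>\<le>\<^sub>0")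
    case False
    have "(\<lambda>z. rGamma (5 * z) / rGamma z) \<midarrow>a\<rightarrow> rGamma (5 * a) / rGamma a"
      using False
      by (intro tendsto_divide isContD[where f = rGamma] isContD[where f = "\<lambda>z. rGamma (5 * z)"]
            continuous_intros) (auto simp: rGamma_eq_zero_iff)
    thus ?thesis unfolding eq by blast
  next
    case True
    then obtain n where n: "a = - of_nat n" by (elim nonpos_Ints_cases')
    have a5: "5 * a = - of_nat (5 * n)" by (simp add: n)
    define D where "D = (\<lambda>n. (-1) ^ n * fact n :: complex)"
    have d1: "(rGamma has_field_derivative D n) (at a)"
      unfolding n D_def by (rule has_field_derivative_rGamma_nonpos_int)
    have d5: "(rGamma has_field_derivative D (5 * n)) (at (5 * a))"
      unfolding a5 D_def by (rule has_field_derivative_rGamma_nonpos_int)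
    have d2: "((\<lambda>z. rGamma (5 * z)) has_field_derivative D (5 * n) * 5) (at a)"
      by (rule DERIV_chain2[where f = rGamma and g = "\<lambda>z. 5 * z", OF d5]) (auto intro!: derivative_eq_intros)
    have z: "rGamma a = 0" "rGamma (5 * a) = 0"
      unfolding a5 unfolding n by (simp_all add: rGamma_eq_zero_iff del: of_nat_mult)
    have "(\<lambda>z. ((rGamma (5 * z) - rGamma (5 * a)) / (z - a)) / ((rGamma z - rGamma a) / (z - a)))
       \<midarrow>a\<rightarrow> (D (5 * n) * 5) / D n"
      by (intro tendsto_divide d1[unfolded has_field_derivative_iff] d2[unfolded has_field_derivative_iff])
         (auto simp: D_def)
    hence "(\<lambda>z. rGamma (5 * z) / rGamma z) \<midarrow>a\<rightarrow> (D (5 * n) * 5) / D n"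
      by (rule Lim_transform_eventually) (auto simp: eventually_at_filter z)
    thus ?thesis unfolding eq by blast
  qed
  then obtain c where "(\<lambda>z. Gamma z / Gamma (5 * z)) \<midarrow>a\<rightarrow> c" by blast
  thus ?thesis unfolding Gamma_quotient_def using remove_sings_eqI by metis
qed

end

theory Submission
  imports Defs
begin

text \<open>
  For \<open>1/6 < a < 1/2\<close> Euler's integral expresses the series through the integral of
  \<open>t^(5a-1) (1-t)^(-a-1/2) (1-t/25)^(1/2-3a) (1-16t/25)^(-2a)\<close> over \<open>(0, 1)\<close>. The parameters are
  special in that \<open>(1-t) (25-t)^3 (25-16t)^2 + 6^6 t^5\<close> is the square of a cubic \<open>P\<close>, and
  \<open>5 P - 2 t P' = (25-t)^2 (25-16t)\<close>. Hence \<open>s = 6^6 t^5 / P^2\<close> turns the integral into a multiple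
  of the integral of \<open>s^(a-1) (1-s)^(-a-1/2)\<close>, which is \<open>B(a, 1/2-a)\<close>. The identity extends to all
  complex \<open>a\<close> because the series is holomorphic in its parameters, and to the removable
  singularities by continuity.
\<close>

section \<open>Products of two binomial series\<close>

text \<open>The coefficient of \<open>t^k\<close> in \<open>(1 - x t)^(-b) (1 - y t)^(-c)\<close>.\<close>

definition appell_diag :: "'a \<Rightarrow> 'a \<Rightarrow> 'a \<Rightarrow> 'a \<Rightarrow> nat \<Rightarrow> 'a::field_char_0" where
  "appell_diag b c x y k =
     (\<Sum>i\<le>k. pochhammer b i / fact i * x ^ i * (pochhammer c (k - i) / fact (k - i) * y ^ (k - i)))"

lemma appell_diag_of_real:
  "appell_diag (of_real b) (of_real c) (of_real x) (of_real y) k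
     = (of_real (appell_diag b c x y k) :: complex)"
  by (simp add: appell_diag_def pochhammer_of_real)

lemma pochhammer_nonneg: "0 \<le> b \<Longrightarrow> 0 \<le> pochhammer (b :: real) n"
  by (simp add: pochhammer_prod prod_nonneg)

lemma appell_diag_nonneg:
  fixes b c x y :: real
  assumes "0 \<le> b" "0 \<le> c" "0 \<le> x" "0 \<le> y"
  shows "0 \<le> appell_diag b c x y k"
  unfolding appell_diag_def using assms
  by (intro sum_nonneg mult_nonneg_nonneg divide_nonneg_nonneg pochhammer_nonneg zero_le_power) auto

lemma norm_pochhammer_le:
  fixes a :: complex
  assumes "norm a \<le> M"
  shows "norm (pochhammer a n) \<le> pochhammer M n"
  unfolding pochhammer_prod prod_norm [symmetric]
proof (rule prod_mono, safe)
  fix i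
  have "norm (a + of_nat i) \<le> norm a + norm (of_nat i :: complex)"
    by (rule norm_triangle_ineq)
  thus "norm (a + of_nat i) \<le> M + of_nat i"
    using assms by simp
qed auto

text \<open>The triangle inequality applies to every factor of the Pochhammer symbols, so a single
  majorant serves all \<open>b\<close> and \<open>c\<close> in the disc of radius \<open>M\<close>.
  This uniformity is what the M-test in the holomorphy proof needs.\<close>

lemma norm_appell_diag_le:
  fixes b c x y :: complex
  assumes "norm b \<le> M" "norm c \<le> M"
  shows "norm (appell_diag b c x y k) \<le> appell_diag M M (norm x) (norm y) k"
proof -
  have M: "0 \<le> M" using assms(1) norm_ge_zero order_trans by blast
  show ?thesis
    unfolding appell_diag_def
  proof (rule sum_norm_le)
    fix i
    show "norm (pochhammer b i / fact i * x ^ i *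
            (pochhammer c (k - i) / fact (k - i) * y ^ (k - i)))
        \<le> pochhammer M i / fact i * norm x ^ i *
            (pochhammer M (k - i) / fact (k - i) * norm y ^ (k - i))"
      unfolding norm_mult norm_divide norm_power norm_fact
      by (intro mult_mono divide_right_mono norm_pochhammer_le assms mult_nonneg_nonneg
            divide_nonneg_nonneg pochhammer_nonneg zero_le_power M) auto
  qed
qed

lemma one_minus_powr_minus_sums:
  fixes b x :: real
  assumes "\<bar>x\<bar> < 1"
  shows "(\<lambda>n. pochhammer b n / fact n * x ^ n) sums (1 - x) powr (- b)"
proof -
  have "((- b) gchoose n) * (- x) ^ n = pochhammer b n / fact n * x ^ n" for n
  proof -
    have "(- 1) ^ n * (- x) ^ n = x ^ n" by (simp flip: power_mult_distrib)
    thus ?thesis by (simp add: gbinomial_pochhammer mult.assoc mult.left_commute [of "(- 1) ^ n"])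
  qed
  thus ?thesis using gen_binomial_real [of "- x" "- b"] assms by simp
qed

text \<open>Cauchy product of two binomial series. The sign conditions make their terms nonnegative,
  so convergence is already the absolute convergence that the product theorem requires.\<close>

lemma appell_diag_power_sums:
  fixes b c x y t :: real
  assumes "0 \<le> b" "0 \<le> c" "0 \<le> x" "0 \<le> y" "0 \<le> t" "x * t < 1" "y * t < 1"
  shows "(\<lambda>k. appell_diag b c x y k * t ^ k) sums ((1 - x * t) powr (- b) * (1 - y * t) powr (- c))"
proof -
  let ?f = "\<lambda>b x n. pochhammer b n / fact n * (x * t) ^ n :: real"
  have sums: "?f b x sums (1 - x * t) powr (- b)" "?f c y sums (1 - y * t) powr (- c)"
    using assms by (auto intro!: one_minus_powr_minus_sums simp del: times_divide_eq_left)
  have "norm (?f b x n) = ?f b x n" "norm (?f c y n) = ?f c y n" for n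
    using assms by (simp_all add: pochhammer_nonneg)
  hence "(\<lambda>k. \<Sum>i\<le>k. ?f b x i * ?f c y (k - i)) sums ((\<Sum>k. ?f b x k) * (\<Sum>k. ?f c y k))"
    using sums by (intro Cauchy_product_sums) (simp_all add: sums_iff)
  moreover have "(\<Sum>i\<le>k. ?f b x i * ?f c y (k - i)) = appell_diag b c x y k * t ^ k" for k
    unfolding appell_diag_def sum_distrib_right
  proof (rule sum.cong [OF refl])
    fix i assume "i \<in> {..k}"
    hence "t ^ k = t ^ i * t ^ (k - i)" by (simp flip: power_add)
    thus "?f b x i * ?f c y (k - i) = pochhammer b i / fact i * x ^ i *
        (pochhammer c (k - i) / fact (k - i) * y ^ (k - i)) * t ^ k"
      by (simp add: power_mult_distrib)
  qed
  ultimately show ?thesis using sums by (simp add: sums_iff)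
qed

text \<open>Absolute convergence permits summation along the diagonals \<open>m + n = k\<close>, on
  which the quotient of the Pochhammer symbols of \<alpha> and \<gamma> is constant. The single
  series that results can be integrated and estimated term by term.\<close>

lemma appell_F1_sums:
  assumes "\<gamma> \<notin> \<int>\<^sub>\<le>\<^sub>0" "norm x < 1" "norm y < 1"
  shows "(\<lambda>k. pochhammer \<alpha> k / pochhammer \<gamma> k * appell_diag b c x y k) sums
           appell_F1 \<alpha> b c \<gamma> x y"
proof -
  define f where "f = (\<lambda>(m, n). pochhammer \<alpha> (m + n) * pochhammer b m * pochhammer c n
          / (pochhammer \<gamma> (m + n) * pochhammer 1 m * pochhammer 1 n) * x ^ m * y ^ n)"
  have "(\<lambda>z. norm (f z)) summable_on UNIV"
    using appell_F1_abs_summable [OF assms, of \<alpha> b c] by (simp add: f_def case_prod_unfold)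
  hence "f summable_on UNIV" by (rule abs_summable_summable)
  hence "(f has_sum appell_F1 \<alpha> b c \<gamma> x y) UNIV"
    unfolding appell_F1_def f_def by (rule has_sum_infsum)
  moreover have bij: "bij_betw (\<lambda>(k, i). (i, k - i)) (SIGMA k:UNIV. {..k}) (UNIV :: (nat \<times> nat) set)"
    by (rule bij_betwI [where g = "\<lambda>(m, n). (m + n, m)"]) auto
  ultimately have "((\<lambda>z. f (case z of (k, i) \<Rightarrow> (i, k - i))) has_sum appell_F1 \<alpha> b c \<gamma> x y)
      (SIGMA k:UNIV. {..k})"
    by (simp only: has_sum_reindex_bij_betw [OF bij, of f])
  hence "((\<lambda>k. \<Sum>i\<le>k. f (i, k - i)) has_sum appell_F1 \<alpha> b c \<gamma> x y) UNIV"
    by (rule has_sum_SigmaD) (simp add: has_sum_finite)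
  moreover have "(\<Sum>i\<le>k. f (i, k - i)) = pochhammer \<alpha> k / pochhammer \<gamma> k * appell_diag b c x y k" for k
    unfolding appell_diag_def sum_distrib_left
    by (rule sum.cong) (auto simp: f_def pochhammer_fact mult_ac)
  ultimately show ?thesis by (auto intro: has_sum_imp_sums)
qed

section \<open>Euler's integral for real parameters\<close>

lemma appell_F1_Euler_integral:
  fixes \<alpha> b c \<gamma> x y J :: real
  assumes "0 < \<alpha>" "\<alpha> < \<gamma>" "0 \<le> b" "0 \<le> c" "0 \<le> x" "x < 1" "0 \<le> y" "y < 1"
    \<comment> \<open>\<open>b, c, x, y \<ge> 0\<close> makes all terms nonnegative, so the integrand itself dominates the partial sums.\<close>
    and J: "((\<lambda>t. t powr (\<alpha> - 1) * (1 - t) powr (\<gamma> - \<alpha> - 1) *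
              ((1 - x * t) powr (- b) * (1 - y * t) powr (- c))) has_integral J) {0<..<1}"
  shows "appell_F1 (of_real \<alpha>) (of_real b) (of_real c) (of_real \<gamma>) (of_real x) (of_real y)
           = of_real (J / Beta \<alpha> (\<gamma> - \<alpha>))"
proof -
  let ?w = "\<lambda>t. t powr (\<alpha> - 1) * (1 - t) powr (\<gamma> - \<alpha> - 1)"
  let ?d = "\<lambda>k. appell_diag b c x y k"
  let ?B = "\<lambda>k. Beta (\<alpha> + real k) (\<gamma> - \<alpha>)"
  have xt: "x * t < 1" if "t \<in> {0<..<1}" for t
    using that assms by (intro le_less_trans [OF mult_left_le]) auto
  have yt: "y * t < 1" if "t \<in> {0<..<1}" for t
    using that assms by (intro le_less_trans [OF mult_left_le]) auto
  have diag: "(\<lambda>k. ?d k * t ^ k) sums ((1 - x * t) powr (- b) * (1 - y * t) powr (- c))"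
    if "t \<in> {0<..<1}" for t
    using that assms xt yt by (intro appell_diag_power_sums) auto
  have d0: "0 \<le> ?d k" for k using assms by (intro appell_diag_nonneg)
  have term_int: "((\<lambda>t. ?w t * (?d k * t ^ k)) has_integral ?d k * ?B k) {0<..<1}" for k
  proof -
    have "((\<lambda>t. t powr (\<alpha> + real k - 1) * (1 - t) powr (\<gamma> - \<alpha> - 1)) has_integral ?B k) {0<..<1}"
      using has_integral_Beta_real [of "\<alpha> + real k" "\<gamma> - \<alpha>"] assms
      by (simp add: has_integral_Icc_iff_Ioo)
    hence int: "((\<lambda>t. ?d k * (t powr (\<alpha> + real k - 1) * (1 - t) powr (\<gamma> - \<alpha> - 1)))
        has_integral ?d k * ?B k) {0<..<1}"
      by (rule has_integral_mult_right)
    have "?d k * (t powr (\<alpha> + real k - 1) * (1 - t) powr (\<gamma> - \<alpha> - 1))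
        = ?w t * (?d k * t ^ k)" if "t \<in> {0<..<1}" for t
    proof -
      have "t powr (\<alpha> + real k - 1) = t powr (\<alpha> - 1) * t ^ k"
        using that by (simp add: powr_add [symmetric] algebra_simps flip: powr_realpow)
      thus ?thesis by simp
    qed
    with int show ?thesis by (rule has_integral_eq [rotated])
  qed
  have part: "((\<lambda>t. \<Sum>k<n. ?w t * (?d k * t ^ k)) has_integral (\<Sum>k<n. ?d k * ?B k)) {0<..<1}" for n
    by (intro has_integral_sum term_int) auto
  have "(\<lambda>n. integral {0<..<1} (\<lambda>t. \<Sum>k<n. ?w t * (?d k * t ^ k))) \<longlonglongrightarrow>
      integral {0<..<1} (\<lambda>t. ?w t * ((1 - x * t) powr (- b) * (1 - y * t) powr (- c)))"
  proof (rule dominated_convergence)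
    fix n and t :: real assume t: "t \<in> {0<..<1}"
    have s: "(\<lambda>k. ?w t * (?d k * t ^ k)) sums
        (?w t * ((1 - x * t) powr (- b) * (1 - y * t) powr (- c)))"
      by (intro sums_mult diag t)
    have nn: "0 \<le> ?w t * (?d k * t ^ k)" for k using t d0 by simp
    show "norm (\<Sum>k<n. ?w t * (?d k * t ^ k))
        \<le> ?w t * ((1 - x * t) powr (- b) * (1 - y * t) powr (- c))"
      using sum_le_suminf [OF sums_summable [OF s], of "{..<n}"] nn s
      by (simp add: sum_nonneg sums_iff)
  next
    fix t :: real assume t: "t \<in> {0<..<1}"
    show "(\<lambda>n. \<Sum>k<n. ?w t * (?d k * t ^ k)) \<longlonglongrightarrow>
        ?w t * ((1 - x * t) powr (- b) * (1 - y * t) powr (- c))"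
      using sums_mult [OF diag [OF t], of "?w t"] by (simp add: sums_def)
  qed (use part J in \<open>auto simp: integrable_on_def\<close>)
  hence "(\<lambda>k. ?d k * ?B k) sums J"
    by (simp only: sums_def integral_unique [OF J] integral_unique [OF part])
  hence "(\<lambda>k. ?d k * ?B k / Beta \<alpha> (\<gamma> - \<alpha>)) sums (J / Beta \<alpha> (\<gamma> - \<alpha>))"
    by (rule sums_divide)
  \<comment> \<open>In the quotient of Beta values \<open>Gamma (\<gamma> - \<alpha>)\<close>
    cancels, and the shift by \<open>k\<close> in the other Gamma factors leaves exactly the two
    Pochhammer symbols.\<close>
  moreover have "?d k * ?B k / Beta \<alpha> (\<gamma> - \<alpha>) = pochhammer \<alpha> k / pochhammer \<gamma> k * ?d k" for k
  proof -
    have "z \<notin> \<int>\<^sub>\<le>\<^sub>0" "Gamma z \<noteq> 0" if "0 < z" for z :: real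
      using that less_imp_neq [OF Gamma_real_pos [OF that]] by (auto elim!: nonpos_Ints_cases)
    moreover have "0 < \<gamma> - \<alpha>" "0 < \<gamma>" "0 < \<gamma> + real k" using assms by auto
    ultimately have "Gamma \<alpha> \<noteq> 0" "Gamma (\<gamma> - \<alpha>) \<noteq> 0" "Gamma \<gamma> \<noteq> 0" "Gamma (\<gamma> + real k) \<noteq> 0"
        "\<alpha> \<notin> \<int>\<^sub>\<le>\<^sub>0" "\<gamma> \<notin> \<int>\<^sub>\<le>\<^sub>0"
      using \<open>0 < \<alpha>\<close> by blast+
    thus ?thesis by (simp add: Beta_def pochhammer_Gamma divide_simps add_ac)
  qed
  ultimately have "(\<lambda>k. pochhammer \<alpha> k / pochhammer \<gamma> k * ?d k) sums (J / Beta \<alpha> (\<gamma> - \<alpha>))"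
    by simp
  hence "(\<lambda>k. complex_of_real (pochhammer \<alpha> k / pochhammer \<gamma> k * ?d k)) sums
      of_real (J / Beta \<alpha> (\<gamma> - \<alpha>))"
    by (rule sums_of_real)
  moreover have "(\<lambda>k. complex_of_real (pochhammer \<alpha> k / pochhammer \<gamma> k * ?d k)) sums
      appell_F1 (of_real \<alpha>) (of_real b) (of_real c) (of_real \<gamma>) (of_real x) (of_real y)"
  proof -
    have "complex_of_real \<gamma> \<notin> \<int>\<^sub>\<le>\<^sub>0" using assms by (auto elim!: nonpos_Ints_cases simp: complex_eq_iff)
    thus ?thesis
      using appell_F1_sums [of "of_real \<gamma>" "of_real x" "of_real y" "of_real \<alpha>" "of_real b" "of_real c"] assms
      by (simp add: appell_diag_of_real pochhammer_of_real)
  qed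
  ultimately show ?thesis by (rule sums_unique2 [symmetric])
qed

section \<open>Holomorphy in the parameters\<close>

text \<open>The partial sums over diagonals are holomorphic, so locally uniform convergence
  suffices. On a closed disc the M-test gives it: the quotient of Pochhammer symbols is at most a
  constant times \<open>(1 / r) ^ k\<close>, with \<open>r < 1\<close> close enough to 1 for the
  binomial majorant to absorb this growth.\<close>

lemma appell_F1_holomorphic:
  assumes S: "open S"
    and hol: "\<alpha> holomorphic_on S" "b holomorphic_on S" "c holomorphic_on S" "\<gamma> holomorphic_on S"
    and \<gamma>: "\<And>z. z \<in> S \<Longrightarrow> \<gamma> z \<notin> \<int>\<^sub>\<le>\<^sub>0"
    and xy: "norm x < 1" "norm y < 1"
  shows "(\<lambda>z. appell_F1 (\<alpha> z) (b z) (c z) (\<gamma> z) x y) holomorphic_on S"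
proof -
  define T where "T = (\<lambda>k z. pochhammer (\<alpha> z) k / pochhammer (\<gamma> z) k * appell_diag (b z) (c z) x y k)"
  have hol_poch: "(\<lambda>z. pochhammer (f z) k) holomorphic_on S" if "f holomorphic_on S" for f k
    unfolding pochhammer_prod by (intro holomorphic_intros that)
  have poch_nz: "pochhammer (\<gamma> z) k \<noteq> 0" if "z \<in> S" for z k
    using \<gamma> [OF that] by (auto simp: pochhammer_eq_0_iff)
  have hol_T: "(\<lambda>z. \<Sum>k<n. T k z) holomorphic_on S" for n
    unfolding T_def appell_diag_def by (intro holomorphic_intros hol_poch hol) (auto simp: poch_nz)
  have F1: "appell_F1 (\<alpha> z) (b z) (c z) (\<gamma> z) x y = (\<Sum>k. T k z)" if "z \<in> S" for z
    using appell_F1_sums [OF \<gamma> [OF that] xy] by (simp add: T_def sums_iff)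
  have "(\<lambda>z. \<Sum>k. T k z) holomorphic_on S"
  proof (rule holomorphic_uniform_sequence [OF S hol_T])
    fix z0 assume "z0 \<in> S"
    then obtain d where d: "0 < d" "cball z0 d \<subseteq> S"
      using S open_contains_cball by blast
    let ?K = "cball z0 d"
    have bounded: "\<exists>M. \<forall>z\<in>?K. norm (f z) \<le> M" if "f holomorphic_on S" for f
      using compact_imp_bounded [OF compact_continuous_image [OF
            holomorphic_on_imp_continuous_on [OF holomorphic_on_subset [OF that d(2)]] compact_cball]]
      by (simp add: bounded_iff)
    obtain M1 where M1: "\<forall>z\<in>?K. norm (\<alpha> z) \<le> M1" using bounded [OF hol(1)] by blast
    obtain M2 where M2: "\<forall>z\<in>?K. norm (b z) \<le> M2" using bounded [OF hol(2)] by blast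
    obtain M3 where M3: "\<forall>z\<in>?K. norm (c z) \<le> M3" using bounded [OF hol(3)] by blast
    obtain M4 where M4: "\<forall>z\<in>?K. norm (\<gamma> z) \<le> M4" using bounded [OF hol(4)] by blast
    define M where "M = max 0 (max M1 (max M2 (max M3 M4)))"
    have M: "norm (\<alpha> z) \<le> M" "norm (b z) \<le> M" "norm (c z) \<le> M" "norm (\<gamma> z) \<le> M"
      if "z \<in> ?K" for z
      using bspec [OF M1 that] bspec [OF M2 that] bspec [OF M3 that] bspec [OF M4 that]
      unfolding M_def by linarith+
    have "0 \<le> M" by (simp add: M_def)
    \<comment> \<open>Beyond index \<open>J\<close> the factors of \<open>(\<gamma>, k)\<close> are bounded below by those of a factorial.\<close>
    define J where "J = nat \<lceil>M\<rceil> + 1"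
    have J: "M + 1 \<le> real J" by (simp add: J_def) linarith
    have fact_le: "fact i \<le> norm (pochhammer (\<gamma> z + of_nat J) i)" if "z \<in> ?K" for z i
    proof -
      have "(\<Prod>j<i. 1 + real j) \<le> (\<Prod>j<i. norm (\<gamma> z + of_nat J + of_nat j))"
      proof (rule prod_mono, safe)
        fix j
        have "- M \<le> Re (\<gamma> z)" using M(4) [OF that] abs_Re_le_cmod [of "\<gamma> z"] by linarith
        hence "1 + real j \<le> Re (\<gamma> z + of_nat J + of_nat j)" using J by simp
        also have "\<dots> \<le> norm (\<gamma> z + of_nat J + of_nat j)" by (rule complex_Re_le_cmod)
        finally show "1 + real j \<le> norm (\<gamma> z + of_nat J + of_nat j)" .
      qed auto
      thus ?thesis by (simp add: pochhammer_fact pochhammer_prod prod_norm atLeast0LessThan)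
    qed
    \<comment> \<open>The first \<open>J\<close> factors have no explicit lower bound. Their product
      does not vanish because \<gamma> avoids the nonpositive integers, and compactness of the disc
      then bounds its reciprocal.\<close>
    obtain N where N: "\<forall>z\<in>?K. norm (1 / pochhammer (\<gamma> z) J) \<le> N"
      using bounded [OF holomorphic_on_divide [OF holomorphic_on_const hol_poch [OF hol(4)] poch_nz]]
      by blast
    have "0 \<le> N" using order_trans [OF norm_ge_zero bspec [OF N, of z0]] d(1) by simp
    \<comment> \<open>The midpoint meets two demands: \<open>r < 1\<close> makes the Pochhammer
      quotients times \<open>r ^ i\<close> bounded, while \<open>norm x < r\<close> and
      \<open>norm y < r\<close> keep the binomial product convergent at
      \<open>1 / r\<close>.\<close>
    define r where "r = (max (norm x) (norm y) + 1) / 2"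
    have r: "norm x < r" "norm y < r" "r < 1" "0 < r" using xy by (auto simp: r_def max_def add_nonneg_pos)
    let ?D = "appell_diag M M (norm x) (norm y)"
    have D0: "0 \<le> ?D k" for k using \<open>0 \<le> M\<close> by (intro appell_diag_nonneg) auto
    have "summable (\<lambda>i. norm (pochhammer (of_real (M + J) :: complex) i / pochhammer 1 i) * r ^ i)"
      using r by (intro summable_pochhammer_quotient) auto
    hence "Bseq (\<lambda>i. norm (pochhammer (of_real (M + J) :: complex) i / pochhammer 1 i) * r ^ i)"
      by (rule convergent_imp_Bseq [OF convergentI [OF summable_LIMSEQ_zero]])
    then obtain C where C: "norm (norm (pochhammer (of_real (M + J) :: complex) i / pochhammer 1 i) * r ^ i) \<le> C" for i
      unfolding Bseq_def by blast
    have C': "pochhammer (M + J) i / fact i * r ^ i \<le> C" for i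
    proof -
      have "0 \<le> pochhammer (M + J) i" using \<open>0 \<le> M\<close> by (intro pochhammer_nonneg) simp
      thus ?thesis using C [of i] r
        by (simp only: pochhammer_of_real pochhammer_fact [symmetric] norm_divide norm_of_real norm_fact
            norm_mult abs_of_nonneg norm_power) (simp add: norm_divide)
    qed
    have "uniform_limit ?K (\<lambda>n z. \<Sum>k<n. T k z) (\<lambda>z. \<Sum>k. T k z) sequentially"
    proof (rule Weierstrass_m_test_ev)
      have "(\<lambda>k. ?D k * (1 / r) ^ k) sums
          ((1 - norm x * (1 / r)) powr (- M) * (1 - norm y * (1 / r)) powr (- M))"
        using r \<open>0 \<le> M\<close> by (intro appell_diag_power_sums) auto
      thus "summable (\<lambda>k. pochhammer M J * N * C * r ^ J * (?D k * (1 / r) ^ k))"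
        by (intro summable_mult) (rule sums_summable)
      have bound: "norm (T k z) \<le> pochhammer M J * N * C * r ^ J * (?D k * (1 / r) ^ k)"
        if k: "J \<le> k" and z: "z \<in> ?K" for k z
      proof -
        have "norm (T k z) = norm (pochhammer (\<alpha> z) k) * norm (1 / pochhammer (\<gamma> z) J)
            * (1 / norm (pochhammer (\<gamma> z + of_nat J) (k - J))) * norm (appell_diag (b z) (c z) x y k)"
          unfolding T_def pochhammer_product [OF k, of "\<gamma> z"] by (simp add: norm_mult norm_divide)
        also have "\<dots> \<le> pochhammer M k * N * (1 / fact (k - J)) * ?D k"
        proof (intro mult_mono mult_nonneg_nonneg)
          show "1 / norm (pochhammer (\<gamma> z + of_nat J) (k - J)) \<le> 1 / fact (k - J)"
            by (intro divide_left_mono fact_le z mult_pos_pos order.strict_trans2 [OF _ fact_le]) auto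
        qed (use N z M \<open>0 \<le> M\<close> \<open>0 \<le> N\<close> in \<open>auto intro!: norm_pochhammer_le norm_appell_diag_le pochhammer_nonneg\<close>)
        \<comment> \<open>Splitting \<open>J\<close> factors off the numerator as well leaves a
          quotient of length \<open>k - J\<close>, which \<open>C'\<close> controls.\<close>
        also have "\<dots> = pochhammer M J * N * ?D k * (pochhammer (M + J) (k - J) / fact (k - J))"
          unfolding pochhammer_product [OF k, of M] by simp
        also have "\<dots> \<le> pochhammer M J * N * ?D k * (C * r ^ J * (1 / r) ^ k)"
        proof (intro mult_left_mono mult_nonneg_nonneg D0 pochhammer_nonneg \<open>0 \<le> M\<close> \<open>0 \<le> N\<close>)
          have "r ^ k = r ^ J * r ^ (k - J)" using k by (simp flip: power_add)
          thus "pochhammer (M + J) (k - J) / fact (k - J) \<le> C * r ^ J * (1 / r) ^ k"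
            using C' [of "k - J"] r by (simp add: power_one_over field_simps)
        qed
        finally show ?thesis by (simp add: mult_ac)
      qed
      show "\<forall>\<^sub>F k in sequentially. \<forall>z\<in>?K. norm (T k z)
          \<le> pochhammer M J * N * C * r ^ J * (?D k * (1 / r) ^ k)"
        by (intro eventually_sequentiallyI [of J] ballI bound)
    qed
    thus "\<exists>d>0. cball z0 d \<subseteq> S \<and>
        uniform_limit (cball z0 d) (\<lambda>n z. \<Sum>k<n. T k z) (\<lambda>z. \<Sum>k. T k z) sequentially"
      using d by blast
  qed
  thus ?thesis by (rule holomorphic_transform) (simp add: F1)
qed

section \<open>The change of variables of degree five\<close>

text \<open>In \<open>s' t * f (s t)\<close> the exponents of \<open>P t\<close> add up to
  \<open>-3 - 2 * (a - 1) + 2 * (a + 1 / 2) = 0\<close>, so only powers of \<open>t\<close>,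
  \<open>1 - t\<close>, \<open>25 - t\<close> and \<open>25 - 16 * t\<close> remain. The constant
  \<open>46656 = 6 ^ 6\<close> contributes \<open>6 powr (6 * a)\<close>; taking 25 out of the last
  two factors contributes \<open>5 powr (1 - 10 * a)\<close>.\<close>

lemma Beta_integral_degree_5:
  fixes a :: real
  assumes a: "0 < a" "a < 1 / 2"
  shows "((\<lambda>t. t powr (5 * a - 1) * (1 - t) powr (- a - 1 / 2) *
            ((1 - 1 / 25 * t) powr (- (3 * a - 1 / 2)) * (1 - 16 / 25 * t) powr (- (2 * a))))
          has_integral 5 powr (10 * a - 1) / 6 powr (6 * a) * Beta a (1 / 2 - a)) {0<..<1}"
    (is "(?F has_integral _) _")
proof -
  define P where "P = (\<lambda>t::real. 3125 - 3750 * t + 825 * t ^ 2 + 16 * t ^ 3)"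
  define s where "s = (\<lambda>t. 46656 * t ^ 5 / P t ^ 2)"
  define s' where "s' = (\<lambda>t. 46656 * t ^ 4 * (25 - t) ^ 2 * (25 - 16 * t) / P t ^ 3)"
  define f where "f = (\<lambda>u::real. u powr (a - 1) * (1 - u) powr (1 / 2 - a - 1))"
  have P_pos: "0 < P t" if "0 \<le> t" "t \<le> 1" for t
  proof -
    have "t ^ 2 \<le> 1" using that by (simp add: power_le_one)
    \<comment> \<open>Since \<open>P 1 = 216\<close>, the factor \<open>1 - t\<close> divides
      \<open>P t - 216\<close>; the cofactor is positive because
      \<open>841 + 16 < 2909\<close>.\<close>
    hence "0 \<le> (1 - t) * (2909 - 841 * t - 16 * t ^ 2)"
      using that by (intro mult_nonneg_nonneg) auto
    also have "\<dots> = P t - 216" by (simp add: P_def algebra_simps power2_eq_square power3_eq_cube)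
    finally show ?thesis by simp
  qed
  have one_minus_s: "1 - s t = (1 - t) * (25 - t) ^ 3 * (25 - 16 * t) ^ 2 / P t ^ 2"
    if "0 \<le> t" "t \<le> 1" for t
  proof -
    have "P t ^ 2 - 46656 * t ^ 5 = (1 - t) * (25 - t) ^ 3 * (25 - 16 * t) ^ 2"
      unfolding P_def by algebra
    thus ?thesis using P_pos [OF that] by (simp add: s_def field_simps)
  qed
  have deriv_s: "(s has_field_derivative s' t) (at t)" if "0 \<le> t" "t \<le> 1" for t
  proof -
    define P' where "P' = - 3750 + 1650 * t + 48 * t ^ 2"
    have P: "(P has_field_derivative P') (at t)"
      unfolding P_def P'_def by (auto intro!: derivative_eq_intros)
    have nz: "P t \<noteq> 0" using P_pos [OF that] by simp
    have "(s has_field_derivative (46656 * (5 * t ^ 4) * P t ^ 2 - 46656 * t ^ 5 * (2 * P t * P')) / (P t ^ 2 * P t ^ 2)) (at t)"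
      unfolding s_def using nz by (auto intro!: derivative_eq_intros P)
    also have "(46656 * (5 * t ^ 4) * P t ^ 2 - 46656 * t ^ 5 * (2 * P t * P')) / (P t ^ 2 * P t ^ 2)
        = 46656 * t ^ 4 * (5 * P t - 2 * t * P') / P t ^ 3"
      using nz by (simp add: divide_simps) algebra
    \<comment> \<open>Through this identity the derivative introduces only linear factors that
      already occur in \<open>1 - s t\<close>.\<close>
    also have "5 * P t - 2 * t * P' = (25 - t) ^ 2 * (25 - 16 * t)"
      unfolding P_def P'_def by algebra
    finally show ?thesis by (simp add: s'_def mult_ac)
  qed
  have s'_pos: "0 < s' t" if "0 < t" "t < 1" for t
    using that P_pos [of t] by (simp add: s'_def)
  have s01: "s t \<in> {0<..<1}" if "t \<in> {0<..<1}" for t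
  proof -
    have "0 < s t" using that P_pos [of t] by (simp add: s_def)
    moreover have "0 < 1 - s t" using that P_pos [of t] by (simp add: one_minus_s)
    ultimately show ?thesis by simp
  qed
  have inj: "inj_on s {0<..<1}"
  proof (rule linorder_inj_onI)
    fix x y :: real assume "x < y" "x \<in> {0<..<1}" "y \<in> {0<..<1}"
    hence "s x < s y"
      by (intro DERIV_pos_imp_increasing [OF \<open>x < y\<close>]) (auto intro!: exI [of _ "s' _"] deriv_s s'_pos)
    thus "s x \<noteq> s y" by simp
  qed auto
  have image: "s ` {0<..<1} = {0<..<1}"
  proof (intro equalityI subsetI)
    fix u :: real assume u: "u \<in> {0<..<1}"
    have s_ends: "s 0 = 0" "s 1 = 1" by (simp_all add: s_def P_def)
    have "\<exists>t. 0 \<le> t \<and> t \<le> 1 \<and> s t = u"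
      using u s_ends by (intro IVT) (auto intro!: DERIV_isCont deriv_s)
    then obtain t where t: "0 \<le> t" "t \<le> 1" "s t = u" by blast
    hence "t \<noteq> 0" "t \<noteq> 1" using u s_ends by auto
    thus "u \<in> s ` {0<..<1}" using t by force
  qed (use s01 in auto)
  have f: "(f has_integral Beta a (1 / 2 - a)) {0<..<1}"
    using has_integral_Beta_real [of a "1 / 2 - a"] a by (simp add: f_def has_integral_Icc_iff_Ioo)
  hence "f absolutely_integrable_on {0<..<1}"
    by (intro nonnegative_absolutely_integrable_1) (auto simp: f_def integrable_on_def)
  hence "(\<lambda>t. \<bar>s' t\<bar> * f (s t)) absolutely_integrable_on {0<..<1} \<and>
      integral {0<..<1} (\<lambda>t. \<bar>s' t\<bar> * f (s t)) = Beta a (1 / 2 - a)"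
    using f image
    by (subst has_absolute_integral_change_of_variables_1' [OF _ _ inj])
       (auto intro!: has_field_derivative_at_within [OF deriv_s] simp: integral_unique)
  hence "((\<lambda>t. \<bar>s' t\<bar> * f (s t)) has_integral Beta a (1 / 2 - a)) {0<..<1}"
    by (metis set_lebesgue_integral_eq_integral(1) integrable_integral)
  hence "((\<lambda>t. 5 powr (10 * a - 1) / 6 powr (6 * a) * (\<bar>s' t\<bar> * f (s t))) has_integral
      5 powr (10 * a - 1) / 6 powr (6 * a) * Beta a (1 / 2 - a)) {0<..<1}"
    by (rule has_integral_mult_right)
  moreover have "5 powr (10 * a - 1) / 6 powr (6 * a) * (\<bar>s' t\<bar> * f (s t)) = ?F t" if "t \<in> {0<..<1}" for t
  proof -
    have t: "0 < t" "t < 1" using that by auto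
    note pos = t P_pos [of t] s'_pos [OF t] s01 [OF that]
    have ln6: "ln (46656 :: real) = 6 * ln 6" using ln_realpow [of "6 :: real" 6] by simp
    have ln25: "ln (25 :: real) = 2 * ln 5" using ln_realpow [of "5 :: real" 2] by simp
    have "ln (1 - 1 / 25 * t) = ln ((25 - t) / 25)" by (simp add: field_simps)
    also have "\<dots> = ln (25 - t) - 2 * ln 5" using t by (simp add: ln_div ln25)
    finally have l1: "ln (1 - 1 / 25 * t) = ln (25 - t) - 2 * ln 5" .
    have "ln (1 - 16 / 25 * t) = ln ((25 - 16 * t) / 25)" by (simp add: field_simps)
    also have "\<dots> = ln (25 - 16 * t) - 2 * ln 5" using t by (simp add: ln_div ln25)
    finally have l2: "ln (1 - 16 / 25 * t) = ln (25 - 16 * t) - 2 * ln 5" .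
    have l3: "ln (s' t) = 6 * ln 6 + 4 * ln t + 2 * ln (25 - t) + ln (25 - 16 * t) - 3 * ln (P t)"
      using pos by (simp add: s'_def ln_mult ln_div ln_realpow ln6)
    have l4: "ln (s t) = 6 * ln 6 + 5 * ln t - 2 * ln (P t)"
      using pos by (simp add: s_def ln_mult ln_div ln_realpow ln6)
    have l5: "ln (1 - s t) = ln (1 - t) + 3 * ln (25 - t) + 2 * ln (25 - 16 * t) - 2 * ln (P t)"
      using pos by (simp add: one_minus_s ln_mult ln_div ln_realpow)
    \<comment> \<open>After taking logarithms the identity is polynomial in \<open>a\<close> and the logarithms of the factors.\<close>
    have "ln (5 powr (10 * a - 1) / 6 powr (6 * a) * (s' t * f (s t)))
        = (10 * a - 1) * ln 5 - 6 * a * ln 6 + (ln (s' t) + ((a - 1) * ln (s t) + (1 / 2 - a - 1) * ln (1 - s t)))"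
      using pos by (simp add: f_def ln_mult ln_div ln_powr)
    also have "\<dots> = ((5 * a - 1) * ln t + (- a - 1 / 2) * ln (1 - t)) +
        (- (3 * a - 1 / 2) * ln (1 - 1 / 25 * t) + - (2 * a) * ln (1 - 16 / 25 * t))"
      unfolding l1 l2 l3 l4 l5 by algebra
    also have "\<dots> = ln (?F t)"
      using pos by (simp add: ln_mult ln_div ln_powr)
    finally have "ln (5 powr (10 * a - 1) / 6 powr (6 * a) * (s' t * f (s t))) = ln (?F t)" .
    moreover have "0 < 5 powr (10 * a - 1) / 6 powr (6 * a) * (s' t * f (s t))" "0 < ?F t"
      using pos by (auto simp: f_def)
    ultimately show ?thesis using pos by (subst (asm) ln_inj_iff) auto
  qed
  ultimately show ?thesis by (rule has_integral_eq [rotated])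
qed

section \<open>The closed form on a real interval\<close>

text \<open>The bound \<open>1 / 6 < a\<close> makes \<open>3 * a - 1 / 2\<close> nonnegative, as
  the Euler integral lemma demands; \<open>a < 1 / 2\<close> makes the second Beta parameter
  \<open>1 / 2 - a\<close> positive. That parameter is common to both Beta functions, so its Gamma
  value cancels, and the \<open>Gamma (1 / 2)\<close> left over gives
  \<open>sqrt pi\<close>.\<close>

lemma appell_F1_closed_form_real:
  fixes a :: real
  assumes a: "1 / 6 < a" "a < 1 / 2"
  defines "z \<equiv> complex_of_real a"
  shows "appell_F1 (5 * z) (3 * z - 1 / 2) (2 * z) (4 * z + 1 / 2) (1 / 25) (16 / 25)
       = 5 powr (10 * z - 1) / (2 powr (6 * z) * 3 powr (6 * z))
         * (Gamma z / Gamma (5 * z) * Gamma (4 * z + 1 / 2) / of_real (sqrt pi))"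
proof -
  let ?J = "5 powr (10 * a - 1) / 6 powr (6 * a) * Beta a (1 / 2 - a)"
  have "appell_F1 (of_real (5 * a)) (of_real (3 * a - 1 / 2)) (of_real (2 * a))
      (of_real (4 * a + 1 / 2)) (of_real (1 / 25)) (of_real (16 / 25))
      = of_real (?J / Beta (5 * a) (4 * a + 1 / 2 - 5 * a))"
    using Beta_integral_degree_5 [of a] a
    by (intro appell_F1_Euler_integral) (auto simp: algebra_simps)
  moreover have "?J / Beta (5 * a) (4 * a + 1 / 2 - 5 * a)
      = 5 powr (10 * a - 1) / (2 powr (6 * a) * 3 powr (6 * a))
         * (Gamma a / Gamma (5 * a) * Gamma (4 * a + 1 / 2) / sqrt pi)"
  proof -
    have "Gamma (1 / 2 - a) \<noteq> 0" using Gamma_real_pos [of "1 / 2 - a"] a by linarith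
    moreover have "6 powr (6 * a) = 2 powr (6 * a) * 3 powr (6 * a)"
      using powr_mult [of 2 3 "6 * a"] by simp
    ultimately show ?thesis
      by (simp add: Beta_def Gamma_one_half_real)
  qed
  ultimately have "appell_F1 (of_real (5 * a)) (of_real (3 * a - 1 / 2)) (of_real (2 * a))
      (of_real (4 * a + 1 / 2)) (of_real (1 / 25)) (of_real (16 / 25))
      = of_real (5 powr (10 * a - 1) / (2 powr (6 * a) * 3 powr (6 * a))
         * (Gamma a / Gamma (5 * a) * Gamma (4 * a + 1 / 2) / sqrt pi))"
    by (simp only:)
  also have "\<dots> = 5 powr (10 * z - 1) / (2 powr (6 * z) * 3 powr (6 * z))
         * (Gamma z / Gamma (5 * z) * Gamma (4 * z + 1 / 2) / of_real (sqrt pi))"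
    by (simp add: z_def Gamma_complex_of_real [symmetric] powr_of_real [symmetric])
  finally show ?thesis by (simp add: z_def)
qed

section \<open>Continuation to complex parameters\<close>

theorem mainTheorem13:
  fixes a :: complex
  assumes "4 * a + 1 / 2 \<notin> \<int>\<^sub>\<le>\<^sub>0"
  shows "appell_F1 (5 * a) (3 * a - 1 / 2) (2 * a) (4 * a + 1 / 2) (1 / 25) (16 / 25)
       = 5 powr (10 * a - 1) / (2 powr (6 * a) * 3 powr (6 * a))
         * (Gamma_quotient a * Gamma (4 * a + 1 / 2) / of_real (sqrt pi))"
proof -
  define F where "F = (\<lambda>z. appell_F1 (5 * z) (3 * z - 1 / 2) (2 * z) (4 * z + 1 / 2) (1 / 25) (16 / 25))"
  define E where "E = (\<lambda>z::complex. 5 powr (10 * z - 1) / (2 powr (6 * z) * 3 powr (6 * z)))"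
  define G where "G = (\<lambda>z::complex. E z * (Gamma z / Gamma (5 * z) * Gamma (4 * z + 1 / 2) / of_real (sqrt pi)))"
  define D :: "complex set" where "D = - ((\<lambda>z. 4 * z + 1 / 2) -` \<int>\<^sub>\<le>\<^sub>0)"
  \<comment> \<open>At nonpositive integers the plain quotient in \<open>G\<close> has the default
    value 0 instead of its limit. These points are left out of the identity theorem and recovered at
    the end by continuity.\<close>
  define D' :: "complex set" where "D' = D - \<int>\<^sub>\<le>\<^sub>0"
  have "open D"
    unfolding D_def by (intro open_Compl closed_vimage continuous_intros closed_nonpos_Ints)
  hence "open D'" unfolding D'_def by (intro open_Diff closed_nonpos_Ints)
  have "a \<in> D" using assms by (simp add: D_def)
  \<comment> \<open>Countability of the exceptional set serves twice: its complement in the plane is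
    connected, and every point is a limit point of that complement.\<close>
  define Q :: "complex set" where "Q = \<int>\<^sub>\<le>\<^sub>0 \<union> (\<lambda>z. 4 * z + 1 / 2) -` \<int>\<^sub>\<le>\<^sub>0"
  have D'_eq: "D' = UNIV - Q" by (auto simp: D'_def D_def Q_def)
  have "countable (\<int>\<^sub>\<le>\<^sub>0 :: complex set)"
    by (rule countable_subset [of _ "range of_int"]) (auto elim!: nonpos_Ints_cases)
  moreover from this have "countable ((\<lambda>z::complex. 4 * z + 1 / 2) -` \<int>\<^sub>\<le>\<^sub>0)"
    using countable_image_inj_on [of "\<lambda>z::complex. 4 * z + 1 / 2" "(\<lambda>z. 4 * z + 1 / 2) -` \<int>\<^sub>\<le>\<^sub>0"]
    by (auto intro: countable_subset simp: inj_on_def)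
  ultimately have "countable Q" by (simp add: Q_def)
  have F_hol: "F holomorphic_on D"
    unfolding F_def using \<open>open D\<close>
  proof (rule appell_F1_holomorphic [where \<alpha> = "\<lambda>z. 5 * z" and b = "\<lambda>z. 3 * z - 1 / 2"
          and c = "\<lambda>z. 2 * z" and \<gamma> = "\<lambda>z. 4 * z + 1 / 2"])
    show "4 * z + 1 / 2 \<notin> \<int>\<^sub>\<le>\<^sub>0" if "z \<in> D" for z
      using that by (simp add: D_def)
  qed (intro holomorphic_intros | simp)+
  \<comment> \<open>The default \<open>1 / 0 = 0\<close> agrees with the zeros of the entire
    function \<open>rGamma\<close>, so the poles of \<open>Gamma (5 * z)\<close> inside
    \<open>D'\<close>, such as \<open>z = - 1 / 5\<close>, cause no exception.\<close>
  have "G = (\<lambda>z. E z * (Gamma z * rGamma (5 * z) * Gamma (4 * z + 1 / 2) / of_real (sqrt pi)))"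
    by (simp only: G_def rGamma_inverse_Gamma divide_inverse)
  moreover have "\<dots> holomorphic_on D'"
    unfolding E_def D'_def D_def by (intro holomorphic_intros) auto
  ultimately have G_hol: "G holomorphic_on D'" by simp
  have FG: "F z = G z" if "z \<in> D'" for z
  proof -
    have "F z - G z = 0"
    proof (rule analytic_continuation [where f = "\<lambda>z. F z - G z"])
      show "(\<lambda>z. F z - G z) holomorphic_on D'"
        using F_hol G_hol by (intro holomorphic_intros holomorphic_on_subset [OF F_hol]) (auto simp: D'_def)
      show "connected D'"
        unfolding D'_eq using \<open>countable Q\<close> by (intro connected_open_diff_countable) auto
      have mem: "complex_of_real x \<in> D'" if "0 < x" for x
        using that by (auto simp: D'_def D_def complex_eq_iff elim!: nonpos_Ints_cases)
      show "complex_of_real ` {1 / 6<..<1 / 2} \<subseteq> D'" using mem by auto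
      show "complex_of_real (1 / 3) \<in> D'" by (rule mem) simp
      show "complex_of_real (1 / 3) islimpt complex_of_real ` {1 / 6<..<1 / 2}"
        unfolding islimpt_approachable
      proof (intro allI impI)
        fix e :: real assume "0 < e"
        \<comment> \<open>The cap \<open>1 / 12\<close> keeps \<open>x\<close> at most
          \<open>5 / 12\<close>, inside the interval.\<close>
        define x where "x = 1 / 3 + min (e / 2) (1 / 12)"
        have "x \<in> {1 / 6<..<1 / 2}" "x \<noteq> 1 / 3" "\<bar>x - 1 / 3\<bar> < e"
          using \<open>0 < e\<close> by (auto simp: x_def)
        thus "\<exists>w\<in>complex_of_real ` {1 / 6<..<1 / 2}. w \<noteq> complex_of_real (1 / 3) \<and>
            dist w (complex_of_real (1 / 3)) < e"
          by (intro bexI [of _ "complex_of_real x"]) (auto simp: dist_of_real dist_real_def simp del: of_real_divide)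
      qed
      show "F z - G z = 0" if "z \<in> complex_of_real ` {1 / 6<..<1 / 2}" for z
        using that appell_F1_closed_form_real by (auto simp: F_def G_def E_def)
    qed (use \<open>open D'\<close> that in auto)
    thus ?thesis by simp
  qed
  \<comment> \<open>The point \<open>a\<close> may itself be one of the removed nonpositive
    integers; approaching it within \<open>D'\<close> makes the limit of \<open>G\<close> unique in
    either case.\<close>
  have "a islimpt D'"
    unfolding islimpt_approachable
  proof (intro allI impI)
    fix e :: real assume "0 < e"
    have "uncountable (ball a e - insert a Q)"
      using \<open>countable Q\<close> uncountable_ball [OF \<open>0 < e\<close>] by (intro uncountable_minus_countable) auto
    hence "ball a e - insert a Q \<noteq> {}" by (metis countable_empty)
    thus "\<exists>w\<in>D'. w \<noteq> a \<and> dist w a < e"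
      by (auto simp: D'_eq dist_commute)
  qed
  hence nontriv: "at a within D' \<noteq> bot" by (simp add: trivial_limit_within)
  have "(F \<longlongrightarrow> F a) (at a within D')"
    using F_hol \<open>open D\<close> \<open>a \<in> D\<close>
    by (meson continuous_on_eq_continuous_at holomorphic_on_imp_continuous_on isContD tendsto_within_subset subset_UNIV)
  moreover have "eventually (\<lambda>z. F z = G z) (at a within D')"
    using FG by (auto simp: eventually_at_filter)
  ultimately have "(G \<longlongrightarrow> F a) (at a within D')" by (rule Lim_transform_eventually)
  moreover have "(G \<longlongrightarrow> E a * (Gamma_quotient a * Gamma (4 * a + 1 / 2) / of_real (sqrt pi))) (at a within D')"
  proof -
    have "isCont E a" unfolding E_def by (intro continuous_intros) auto
    hence "(E \<longlongrightarrow> E a) (at a within D')"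
      by (meson isContD tendsto_within_subset subset_UNIV)
    moreover have "((\<lambda>z. Gamma z / Gamma (5 * z)) \<longlongrightarrow> Gamma_quotient a) (at a within D')"
      by (rule tendsto_within_subset [OF Gamma_quotient_tendsto]) simp
    ultimately show ?thesis
      unfolding G_def using assms by (intro tendsto_intros) auto
  qed
  ultimately show ?thesis
    using tendsto_unique [OF nontriv] unfolding F_def E_def by blast
qed

end
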